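(* Let $\mathcal{P}$ be a hereditary graph property, and suppose that $L \notin \mathcal{P}$ for some bipartite graph $L$. Then there exists $\varepsilon = \varepsilon(L) > 0$ such that for every fixed $p \in (0,1)$, with probability tending to $1$ as $n \to \infty$, \[ \operatorname{ex}(G(n,p),\mathcal{P}) \le n^{2-\varepsilon}. \]
   Context: $G(n,p)$ denotes the Erdős–Rényi random graph on vertex set $[n]=\{1,\dots,n\}$ in which each pair of vertices is an edge independently with probability $p$. A hereditary property $\mathcal{P}$ is a collection of graphs closed under isomorphism and under taking induced subgraphs (if $G \in \mathcal{P}$ then $G[S] \in \mathcal{P}$ for all $S \subseteq V(G)$); it is assumed that every hereditary property contains all edgeless graphs. For a graph $G$, $\operatorname{ex}(G,\mathcal{P})$ denotes the maximum number of edges of a subgraph of $G$ that belongs to $\mathcal{P}$. *)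

theory Defs
  imports "HOL-Library.Ramsey" "HOL-Probability.Probability"
begin

type_synonym 'a ugraph = "'a set \<times> 'a set set"

abbreviation verts :: "'a ugraph \<Rightarrow> 'a set" where "verts G \<equiv> fst G"
abbreviation edges :: "'a ugraph \<Rightarrow> 'a set set" where "edges G \<equiv> snd G"

definition finite_graph :: "'a ugraph \<Rightarrow> bool" where
  "finite_graph G \<longleftrightarrow> finite (verts G) \<and> edges G \<subseteq> nsets (verts G) 2"

definition isomorphic :: "'a ugraph \<Rightarrow> 'b ugraph \<Rightarrow> bool" where
  "isomorphic G H \<longleftrightarrow>
     (\<exists>f. bij_betw f (verts G) (verts H) \<and>
          (\<forall>x\<in>verts G. \<forall>y\<in>verts G. {x, y} \<in> edges G \<longleftrightarrow> {f x, f y} \<in> edges H))"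

definition subgraph :: "'a ugraph \<Rightarrow> 'a ugraph \<Rightarrow> bool" where
  "subgraph H G \<longleftrightarrow> finite_graph H \<and> verts H \<subseteq> verts G \<and> edges H \<subseteq> edges G"

definition induced :: "'a ugraph \<Rightarrow> 'a set \<Rightarrow> 'a ugraph" where
  "induced G S = (S, {e \<in> edges G. e \<subseteq> S})"

definition bipartite :: "'a ugraph \<Rightarrow> bool" where
  "bipartite G \<longleftrightarrow>
     (\<exists>A B. A \<union> B = verts G \<and> A \<inter> B = {} \<and>
            (\<forall>e\<in>edges G. \<exists>a\<in>A. \<exists>b\<in>B. e = {a, b}))"

text \<open>The last conjunct is the convention that every hereditary property contains all edgeless
  graphs.\<close>

definition hereditary_property :: "'a ugraph set \<Rightarrow> bool" where
  "hereditary_property P \<longleftrightarrow>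
     (\<forall>G\<in>P. finite_graph G) \<and>
     (\<forall>G\<in>P. \<forall>H. finite_graph H \<and> isomorphic G H \<longrightarrow> H \<in> P) \<and>
     (\<forall>G\<in>P. \<forall>S\<subseteq>verts G. induced G S \<in> P) \<and>
     (\<forall>V. finite V \<longrightarrow> (V, {}) \<in> P)"

definition ex_num :: "'a ugraph \<Rightarrow> 'a ugraph set \<Rightarrow> nat" where
  "ex_num G P = Max {card (edges H) | H. subgraph H G \<and> H \<in> P}"

definition gnp :: "nat \<Rightarrow> real \<Rightarrow> nat ugraph pmf" where
  "gnp n p =
     map_pmf (\<lambda>X. ({1..n}, {e \<in> nsets {1..n} 2. X e}))
       (Pi_pmf (nsets {1..n} 2) False (\<lambda>_. bernoulli_pmf p))"

text \<open>The maximum defining \<^const>\<open>ex_num\<close> is taken over a finite nonempty set.\<close>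

lemma ex_num_set_finite_nonempty:
  assumes "finite_graph G" and "hereditary_property P"
  shows "finite {card (edges H) | H. subgraph H G \<and> H \<in> P}"
    and "{card (edges H) | H. subgraph H G \<and> H \<in> P} \<noteq> {}"
proof -
  have "finite (edges G)"
    using assms(1) finite_imp_finite_nsets finite_subset unfolding finite_graph_def by blast
  then have "{card (edges H) | H. subgraph H G \<and> H \<in> P} \<subseteq> {..card (edges G)}"
    by (auto simp: subgraph_def intro: card_mono)
  then show "finite {card (edges H) | H. subgraph H G \<and> H \<in> P}"
    using finite_subset by blast
  have "subgraph ({}, {}) G" "({}, {}) \<in> P"
    using assms(2) by (auto simp: subgraph_def finite_graph_def hereditary_property_def)
  then show "{card (edges H) | H. subgraph H G \<and> H \<in> P} \<noteq> {}"
    by blast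
qed

end

theory Submission
  imports Defs "HOL-Real_Asymp.Real_Asymp"
begin

text \<open>
  The only property of \<open>G(n,p)\<close> that matters is that with high probability it contains no
  \<open>K\<^bsub>z,z\<^esub>\<close> with \<open>z = n\<^bsup>\<delta>\<^esup>\<close>, hence neither does any subgraph \<open>H\<close>. In a graph without
  \<open>K\<^bsub>z,z\<^esub>\<close>, all but \<open>z\<close> vertices have at least \<open>|W| / z\<^sup>2\<close> non-neighbours in a given large set \<open>W\<close>,
  so non-adjacency is always available at the cost of a factor \<open>z\<^sup>2\<close>. If \<open>H\<close> has more than
  \<open>n\<^bsup>2-\<delta>\<^esup>\<close> edges, dependent random choice gives a large set \<open>U\<close> in which any few vertices have many
  common neighbours. A random sequence in \<open>U\<close> then realises every adjacency pattern on few of its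
  vertices by many vertices of \<open>H\<close>. Choosing one side of \<open>L\<close> independently inside this sequence, and
  the other side independently among the vertices realising the prescribed patterns, embeds \<open>L\<close> as
  an induced subgraph of \<open>H\<close>. All sizes are expressed as powers of \<open>z\<close>, with \<open>\<delta> = 1 / (k + 2)\<close>.
\<close>

section \<open>Counting lemmas\<close>

lemma real_card_UN_le:
  assumes "finite I"
  shows "real (card (\<Union>i\<in>I. A i)) \<le> (\<Sum>i\<in>I. real (card (A i)))"
  unfolding of_nat_sum[symmetric] of_nat_le_iff using assms by (rule card_UN_le)

text \<open>A nonempty set of size at most \<open>Suc s\<close> arises by inserting an element of
  \<open>V\<close> into a set of size at most \<open>s\<close>; the \<open>+ 1\<close> in the base
  pays for the empty set.\<close>

lemma card_bounded_subsets_le: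
  assumes "finite V"
  shows "finite {S. S \<subseteq> V \<and> card S \<le> s}" "card {S. S \<subseteq> V \<and> card S \<le> s} \<le> (card V + 1) ^ s"
proof -
  show fin: "finite {S. S \<subseteq> V \<and> card S \<le> s}" for s
    using assms by auto
  show "card {S. S \<subseteq> V \<and> card S \<le> s} \<le> (card V + 1) ^ s"
  proof (induction s)
    case 0
    have "{S. S \<subseteq> V \<and> card S \<le> 0} = {{}}"
      using assms finite_subset by fastforce
    then show ?case by simp
  next
    case (Suc s)
    let ?C = "{S. S \<subseteq> V \<and> card S \<le> s}"
    have "{S. S \<subseteq> V \<and> card S \<le> Suc s} \<subseteq> (\<lambda>(x, S). insert x S) ` (V \<times> ?C) \<union> ?C"
    proof
      fix S assume S: "S \<in> {S. S \<subseteq> V \<and> card S \<le> Suc s}"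
      show "S \<in> (\<lambda>(x, S). insert x S) ` (V \<times> ?C) \<union> ?C"
      proof (cases "S = {}")
        case False
        then obtain x where x: "x \<in> S" by blast
        then have "(x, S - {x}) \<in> V \<times> ?C" using S by auto
        moreover have "S = insert x (S - {x})" using x by blast
        ultimately show ?thesis by (auto intro!: image_eqI[of _ _ "(x, S - {x})"])
      qed auto
    qed
    then have "card {S. S \<subseteq> V \<and> card S \<le> Suc s}
        \<le> card ((\<lambda>(x, S). insert x S) ` (V \<times> ?C) \<union> ?C)"
      using fin assms by (intro card_mono) auto
    also have "\<dots> \<le> card ((\<lambda>(x, S). insert x S) ` (V \<times> ?C)) + card ?C"
      by (rule card_Un_le)
    also have "\<dots> \<le> card (V \<times> ?C) + card ?C"
      using fin assms by (intro add_mono card_image_le) auto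
    also have "\<dots> = (card V + 1) * card ?C"
      by (simp add: card_cartesian_product)
    also have "\<dots> \<le> (card V + 1) ^ Suc s"
      unfolding power_Suc by (rule mult_le_mono2[OF Suc.IH])
    finally show ?case .
  qed
qed

text \<open>Since \<open>D f\<close> ignores the coordinate \<open>j\<close>, the other coordinates
  determine it; once they are fixed, at most \<open>c\<close> values of \<open>f j\<close>
  remain.\<close>

lemma card_PiE_hit_le:
  fixes c :: real
  assumes "finite U" "finite I" "j \<in> I"
    and indep: "\<And>f x. D (f(j := x)) = D f"
    and bound: "\<And>f. card (D f \<inter> U) \<le> c"
  shows "card {f \<in> I \<rightarrow>\<^sub>E U. f j \<in> D f} \<le> c * card U ^ (card I - 1)"
proof -
  let ?F = "{f \<in> I \<rightarrow>\<^sub>E U. f j \<in> D f}"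
  let ?P = "(I - {j}) \<rightarrow>\<^sub>E U"
  let ?\<phi> = "\<lambda>f. (f(j := undefined), f j)"
  have fin: "finite ?P" using assms by (intro finite_PiE) auto
  have "inj_on ?\<phi> ?F"
  proof (rule inj_onI)
    fix f g assume "?\<phi> f = ?\<phi> g"
    then have "(f(j := undefined))(j := f j) = (g(j := undefined))(j := g j)" by simp
    then show "f = g" by simp
  qed
  moreover have "?\<phi> ` ?F \<subseteq> Sigma ?P (\<lambda>g. D g \<inter> U)"
    using indep \<open>j \<in> I\<close> by (auto simp: PiE_iff extensional_def split: if_splits)
  ultimately have "card ?F \<le> card (Sigma ?P (\<lambda>g. D g \<inter> U))"
    using fin assms(1) by (intro card_inj_on_le[of ?\<phi>]) auto
  also have "\<dots> = (\<Sum>g\<in>?P. card (D g \<inter> U))"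
    using fin assms(1) by (intro card_SigmaI) auto
  finally have "real (card ?F) \<le> (\<Sum>g\<in>?P. real (card (D g \<inter> U)))"
    unfolding of_nat_sum[symmetric] of_nat_le_iff .
  also have "\<dots> \<le> (\<Sum>g\<in>?P. c)"
    by (intro sum_mono bound)
  also have "\<dots> = c * card U ^ (card I - 1)"
    using assms(2,3) by (simp add: card_PiE)
  finally show ?thesis .
qed

lemma sum_card_filter_swap:
  assumes "finite A" "finite B"
  shows "(\<Sum>a\<in>A. real (card {b \<in> B. R a b})) = (\<Sum>b\<in>B. real (card {a \<in> A. R a b}))"
proof -
  have card_eq: "real (card {x \<in> X. Q x}) = (\<Sum>x\<in>X. if Q x then 1 else 0)" if "finite X"
    for X :: "'x set" and Q
    using that by (simp flip: sum.inter_filter)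
  show ?thesis
    unfolding card_eq[OF assms(1)] card_eq[OF assms(2)] by (rule sum.swap)
qed

section \<open>Graphs without large bicliques\<close>

text \<open>\<open>z\<close> is real because it will be the power \<open>n powr \<delta>\<close>;
  with \<open>z \<ge> 4\<close>, one spare factor \<open>z\<close> absorbs constants and additive
  terms. \<open>X\<close> and \<open>Y\<close> may overlap: a common vertex would yield a loop, and
  \<open>E\<close> contains none.\<close>

locale biclique_free =
  fixes V :: "'a set" and E :: "'a set set" and z :: real
  assumes finite_V: "finite V"
    and E_subset: "E \<subseteq> nsets V 2"
    and z_ge_4: "4 \<le> z"
    and no_biclique: "\<And>X Y. X \<subseteq> V \<Longrightarrow> Y \<subseteq> V \<Longrightarrow> z \<le> card X \<Longrightarrow> z \<le> card Y \<Longrightarrow>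
           \<exists>x\<in>X. \<exists>y\<in>Y. {x, y} \<notin> E"
begin

section \<open>Adjacency patterns and independent choices\<close>

text \<open>\<open>pattern {x} {}\<close> is the neighbourhood of \<open>x\<close>, and
  \<open>pattern S {}\<close> the common neighbourhood of \<open>S\<close>. As there are no loops, a
  pattern avoids \<open>S\<close> but may meet \<open>T\<close>.\<close>

definition pattern :: "'a set \<Rightarrow> 'a set \<Rightarrow> 'a set" where
  "pattern S T = {w \<in> V. (\<forall>x\<in>S. {x, w} \<in> E) \<and> (\<forall>x\<in>T. {x, w} \<notin> E)}"

definition crowded :: "'a set \<Rightarrow> 'a set" where
  "crowded W = {x \<in> V. card {w \<in> W. {x, w} \<notin> E} < card W / z\<^sup>2}"

lemma pattern_subset: "pattern S T \<subseteq> V"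
  by (auto simp: pattern_def)

lemma finite_pattern [simp]: "finite (pattern S T)"
  using finite_subset[OF pattern_subset finite_V] .

text \<open>If at least \<open>z\<close> vertices were crowded,
  \<open>\<lceil>z\<rceil> \<le> 2 * z\<close> of them would have non-neighbours covering at most a
  fraction \<open>2 / z \<le> 1 / 2\<close> of \<open>W\<close>. The rest of \<open>W\<close> has at
  least \<open>z\<^sup>2 / 2 \<ge> z\<close> vertices and would form a forbidden biclique with
  them.\<close>

lemma card_crowded_less:
  assumes "W \<subseteq> V" "z\<^sup>2 \<le> card W"
  shows "card (crowded W) < z"
proof (rule ccontr)
  assume "\<not> card (crowded W) < z"
  then have "nat \<lceil>z\<rceil> \<le> card (crowded W)" by linarith
  then obtain X where X: "X \<subseteq> crowded W" "card X = nat \<lceil>z\<rceil>" "finite X"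
    by (metis obtain_subset_with_card_n)
  have cX: "z \<le> card X" "card X \<le> 2 * z"
    using X z_ge_4 by linarith+
  have finW: "finite W" using assms finite_V finite_subset by blast
  define Z where "Z = (\<Union>x\<in>X. {w \<in> W. {x, w} \<notin> E})"
  have ZW: "Z \<subseteq> W" by (auto simp: Z_def)
  have "real (card Z) \<le> (\<Sum>x\<in>X. real (card {w \<in> W. {x, w} \<notin> E}))"
    unfolding Z_def using X(3) by (rule real_card_UN_le)
  also have "\<dots> \<le> (\<Sum>x\<in>X. card W / z\<^sup>2)"
    using X(1) by (intro sum_mono) (auto simp: crowded_def)
  also have "\<dots> = card X * (card W / z\<^sup>2)" by simp
  also have "\<dots> \<le> (2 * z) * (card W / z\<^sup>2)"
    using cX by (intro mult_right_mono) auto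
  also have "\<dots> = (2 / z) * card W"
    using z_ge_4 by (simp add: power2_eq_square)
  also have "\<dots> \<le> (1 / 2) * card W"
    using z_ge_4 by (intro mult_right_mono) (auto simp: field_simps)
  finally have "card Z \<le> card W / 2" by simp
  then have "card W / 2 \<le> card (W - Z)"
    using card_Diff_subset[OF finite_subset[OF ZW finW] ZW] card_mono[OF finW ZW] by linarith
  moreover have "4 * z \<le> z\<^sup>2"
    using z_ge_4 unfolding power2_eq_square by (intro mult_right_mono) auto
  ultimately have "z \<le> card (W - Z)"
    using assms(2) z_ge_4 by linarith
  moreover have "X \<subseteq> V" using X by (auto simp: crowded_def)
  ultimately obtain x y where "x \<in> X" "y \<in> W - Z" "{x, y} \<notin> E"
    using no_biclique[of X "W - Z"] cX assms(1) by blast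
  then show False by (auto simp: Z_def)
qed

text \<open>Greedy selection: fewer than \<open>z\<^sup>2\<close> vertices are crowded for one of
  the remaining sets, so \<open>Y i\<close> contains a vertex that is uncrowded for all of them.
  Each round costs a factor \<open>z ^ 3\<close>: two powers for non-adjacency, one for deleting the
  chosen vertex.\<close>

lemma independent_transversal:
  assumes "finite I" "card I \<le> z"
    and "\<And>i. i \<in> I \<Longrightarrow> Y i \<subseteq> V \<and> z ^ (3 * (card I + 1)) \<le> card (Y i)"
  shows "\<exists>g. (\<forall>i\<in>I. g i \<in> Y i) \<and> (\<forall>i\<in>I. \<forall>j\<in>I. i \<noteq> j \<longrightarrow> g i \<noteq> g j \<and> {g i, g j} \<notin> E)"
  using assms
proof (induction I arbitrary: Y rule: finite_induct)
  case empty
  then show ?case by simp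
next
  case (insert i I)
  let ?k = "card I"
  have Y: "Y l \<subseteq> V" "z ^ (3 * ?k + 6) \<le> card (Y l)" if "l \<in> insert i I" for l
    using insert.prems(2)[OF that] insert.hyps by (simp_all add: algebra_simps)
  have kz: "real ?k + 1 \<le> z" using insert.prems(1) insert.hyps by simp
  have z2: "z\<^sup>2 \<le> card (Y l)" if "l \<in> insert i I" for l
  proof -
    have "z\<^sup>2 \<le> z ^ (3 * ?k + 6)" using z_ge_4 by (intro power_increasing) auto
    then show ?thesis using Y(2)[OF that] by linarith
  qed
  have "real (card (\<Union>l\<in>I. crowded (Y l))) \<le> (\<Sum>l\<in>I. real (card (crowded (Y l))))"
    using insert.hyps(1) by (rule real_card_UN_le)
  also have "\<dots> \<le> (\<Sum>l\<in>I. z)"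
    using card_crowded_less Y z2 by (intro sum_mono less_imp_le) auto
  also have "\<dots> = ?k * z" by simp
  also have "\<dots> < z * z" using kz z_ge_4 by (intro mult_strict_right_mono) auto
  also have "\<dots> \<le> card (Y i)" using z2[of i] by (simp add: power2_eq_square)
  finally have less: "card (\<Union>l\<in>I. crowded (Y l)) < card (Y i)" by simp
  have "finite (\<Union>l\<in>I. crowded (Y l))"
    using insert.hyps(1) finite_V by (auto simp: crowded_def)
  with less have "\<not> Y i \<subseteq> (\<Union>l\<in>I. crowded (Y l))"
    using card_mono leD by blast
  then obtain x where x: "x \<in> Y i" "\<And>l. l \<in> I \<Longrightarrow> x \<notin> crowded (Y l)" by blast
  \<comment> \<open>\<open>x\<close> counts as its own non-neighbour, so it is removed explicitly to
    keep the chosen vertices distinct.\<close>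
  define Y' where "Y' l = {w \<in> Y l. {x, w} \<notin> E} - {x}" for l
  have "z ^ (3 * (?k + 1)) \<le> card (Y' l)" if l: "l \<in> I" for l
  proof -
    have "x \<in> V" using x(1) Y(1)[of i] by auto
    then have "card (Y l) / z\<^sup>2 \<le> card {w \<in> Y l. {x, w} \<notin> E}"
      using x(2)[OF l] unfolding crowded_def by simp
    moreover have "z ^ (3 * ?k + 4) \<le> card (Y l) / z\<^sup>2"
      using Y(2)[of l] l z_ge_4 by (simp add: field_simps flip: power_add)
    moreover have "z ^ (3 * ?k + 4) = z * z ^ (3 * ?k + 3)"
      by (simp add: numeral_eq_Suc)
    moreover have "4 * z ^ (3 * ?k + 3) \<le> z * z ^ (3 * ?k + 3)"
      using z_ge_4 by (intro mult_right_mono) auto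
    moreover have "1 \<le> z ^ (3 * ?k + 3)" using z_ge_4 by (intro one_le_power) auto
    moreover have "real (card {w \<in> Y l. {x, w} \<notin> E}) \<le> card (Y' l) + 1"
      unfolding Y'_def using diff_card_le_card_Diff[of "{x}" "{w \<in> Y l. {x, w} \<notin> E}"] by simp
    ultimately have "z ^ (3 * ?k + 3) \<le> card (Y' l)" by linarith
    then show ?thesis by (simp add: algebra_simps)
  qed
  moreover have "Y' l \<subseteq> V" if "l \<in> I" for l using Y(1)[of l] that by (auto simp: Y'_def)
  ultimately obtain g where g: "\<forall>l\<in>I. g l \<in> Y' l"
      "\<forall>l\<in>I. \<forall>j\<in>I. l \<noteq> j \<longrightarrow> g l \<noteq> g j \<and> {g l, g j} \<notin> E"
    using insert.IH[of Y'] kz by auto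
  show ?case
  proof (intro exI[of _ "g(i := x)"] conjI ballI impI)
    fix l assume "l \<in> insert i I"
    then show "(g(i := x)) l \<in> Y l" using g(1) x(1) by (auto simp: Y'_def)
  next
    fix l j assume lj: "l \<in> insert i I" "j \<in> insert i I" "l \<noteq> j"
    show "(g(i := x)) l \<noteq> (g(i := x)) j" "{(g(i := x)) l, (g(i := x)) j} \<notin> E"
      using lj g insert.hyps(2) by (auto simp: Y'_def insert_commute)
  qed
qed

section \<open>Dependent random choice\<close>

lemma card_edges_le: "card E \<le> (\<Sum>x\<in>V. card (pattern {x} {}))"
proof -
  have "E \<subseteq> (\<lambda>(x, y). {x, y}) ` Sigma V (\<lambda>x. pattern {x} {})"
  proof
    fix e assume "e \<in> E"
    moreover then obtain x y where "e = {x, y}" "x \<in> V" "y \<in> V"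
      using E_subset nsets2_E by blast
    ultimately show "e \<in> (\<lambda>(x, y). {x, y}) ` Sigma V (\<lambda>x. pattern {x} {})"
      by (auto simp: pattern_def intro!: image_eqI[of _ _ "(x, y)"])
  qed
  then have "card E \<le> card (Sigma V (\<lambda>x. pattern {x} {}))"
    using finite_V by (intro surj_card_le) auto
  then show ?thesis using finite_V by simp
qed

text \<open>Vertices of degree below \<open>z ^ (k + 1) / 2\<close> account for at most half of the
  degree sum, and no degree exceeds \<open>z ^ (k + 2)\<close>. Hence at least \<open>z ^ k\<close>
  vertices have degree at least \<open>z ^ k\<close>.\<close>

lemma sum_degree_powers_ge:
  assumes "card V \<le> z ^ (k + 2)" "z ^ (2 * k + 3) \<le> card E"
  shows "(z ^ k) ^ (t + 1) \<le> (\<Sum>x\<in>V. real (card (pattern {x} {})) ^ t)"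
proof -
  define d where "d x = real (card (pattern {x} {}))" for x
  define High where "High = {x \<in> V. z ^ (k + 1) / 2 \<le> d x}"
  have High: "High \<subseteq> V" "finite High"
    using finite_V by (auto simp: High_def)
  have half: "z ^ k \<le> z ^ (k + 1) / 2" using z_ge_4 by simp
  have "z ^ (k + 2) * z ^ (k + 1) = z ^ (2 * k + 3)"
    by (simp add: mult_2 numeral_eq_Suc flip: power_add)
  also have "\<dots> \<le> (\<Sum>x\<in>V. d x)"
    unfolding d_def using assms(2) card_edges_le by (simp flip: of_nat_sum)
  also have "\<dots> \<le> (\<Sum>x\<in>V. (if x \<in> High then z ^ (k + 2) else 0) + z ^ (k + 1) / 2)"
  proof (rule sum_mono)
    fix x assume "x \<in> V"
    have "d x \<le> card V" unfolding d_def
      using card_mono[OF finite_V pattern_subset] by simp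
    moreover have "0 \<le> z ^ (k + 1) / 2" using z_ge_4 by simp
    ultimately show "d x \<le> (if x \<in> High then z ^ (k + 2) else 0) + z ^ (k + 1) / 2"
      using assms(1) \<open>x \<in> V\<close> by (auto simp: High_def)
  qed
  also have "\<dots> = card High * z ^ (k + 2) + card V * (z ^ (k + 1) / 2)"
    using finite_V High
    by (simp add: sum.distrib sum.If_cases Int_absorb1)
  also have "\<dots> \<le> card High * z ^ (k + 2) + z ^ (k + 2) * (z ^ (k + 1) / 2)"
    using assms(1) z_ge_4 by (intro add_left_mono mult_right_mono) auto
  finally have "z ^ (k + 2) * (z ^ (k + 1) / 2) \<le> z ^ (k + 2) * card High"
    by (simp add: algebra_simps)
  then have "z ^ (k + 1) / 2 \<le> card High"
    using z_ge_4 by (subst (asm) mult_le_cancel_left_pos) auto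
  with half have cH: "z ^ k \<le> card High" by linarith
  have "(z ^ k) ^ (t + 1) = z ^ k * (z ^ k) ^ t" by simp
  also have "\<dots> \<le> card High * (z ^ k) ^ t"
    using cH z_ge_4 by (intro mult_right_mono) auto
  also have "\<dots> = (\<Sum>x\<in>High. (z ^ k) ^ t)" by simp
  also have "\<dots> \<le> (\<Sum>x\<in>High. d x ^ t)"
    using order_trans[OF half] z_ge_4
    by (intro sum_mono power_mono) (auto simp: High_def simp del: power_Suc power_add)
  also have "\<dots> \<le> (\<Sum>x\<in>V. d x ^ t)"
    using High finite_V by (intro sum_mono2) (auto simp: d_def)
  finally show ?thesis by (simp add: d_def)
qed

text \<open>\<open>U\<close> is the common neighbourhood of a random sequence of
  \<open>s + 1\<close> vertices. A bad set, one with few common neighbours, lies in \<open>U\<close>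
  only if the whole sequence falls into its small common neighbourhood, which is rare.\<close>

lemma dependent_random_choice:
  fixes M s :: nat
  defines "k \<equiv> M * s + M + 3 * s + 6"
  assumes cardV: "card V \<le> z ^ (k + 2)" and cardE: "z ^ (2 * k + 3) \<le> card E"
  shows "\<exists>U\<subseteq>V. z ^ M \<le> card U \<and> (\<forall>S\<subseteq>U. card S \<le> s \<longrightarrow> z ^ M \<le> card (pattern S {}))"
proof -
  define t where "t = s + 1"
  \<comment> \<open>Sequences may repeat vertices, so exactly \<open>card W ^ t\<close> of them stay
    inside \<open>W\<close>.\<close>
  define Ys where "Ys = {ys. set ys \<subseteq> V \<and> length ys = t}"
  define Bad where "Bad = {S. S \<subseteq> V \<and> card S \<le> s \<and> card (pattern S {}) < z ^ M}"
  define nb where "nb ys = real (card {S \<in> Bad. S \<subseteq> pattern (set ys) {}})" for ys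
  have fin: "finite Ys" "finite Bad"
    using finite_V finite_lists_length_eq[OF finite_V] by (auto simp: Ys_def Bad_def)
  have swap: "S \<subseteq> pattern (set ys) {} \<longleftrightarrow> set ys \<subseteq> pattern S {}" if "ys \<in> Ys" "S \<subseteq> V" for ys S
    using that by (simp add: pattern_def Ys_def subset_iff) (metis insert_commute)
  have U_eq: "pattern (set ys) {} = {x \<in> V. set ys \<subseteq> pattern {x} {}}" if "ys \<in> Ys" for ys
    using that by (auto simp: pattern_def Ys_def insert_commute)
  have card_lists: "real (card {ys \<in> Ys. set ys \<subseteq> W}) = real (card W) ^ t" if "W \<subseteq> V" for W
  proof -
    have "{ys \<in> Ys. set ys \<subseteq> W} = {ys. set ys \<subseteq> W \<and> length ys = t}"
      using that by (auto simp: Ys_def)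
    then show ?thesis
      using card_lists_length_eq[OF finite_subset[OF that finite_V]] by simp
  qed
  have "z ^ (k * (s + 2)) = (z ^ k) ^ (t + 1)"
    by (simp add: t_def flip: power_mult power_add)
  also have "\<dots> \<le> (\<Sum>x\<in>V. real (card (pattern {x} {})) ^ t)"
    by (rule sum_degree_powers_ge[OF cardV cardE])
  also have "\<dots> = (\<Sum>x\<in>V. real (card {ys \<in> Ys. set ys \<subseteq> pattern {x} {}}))"
    using card_lists[OF pattern_subset] by simp
  also have "\<dots> = (\<Sum>ys\<in>Ys. real (card {x \<in> V. set ys \<subseteq> pattern {x} {}}))"
    using finite_V fin(1) by (rule sum_card_filter_swap)
  also have "\<dots> = (\<Sum>ys\<in>Ys. real (card (pattern (set ys) {})))"
    using U_eq by simp
  finally have lower: "z ^ (k * (s + 2)) \<le> (\<Sum>ys\<in>Ys. real (card (pattern (set ys) {})))" .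

  have "real (card Bad) \<le> real (card {S. S \<subseteq> V \<and> card S \<le> s})"
    using card_bounded_subsets_le(1)[OF finite_V] unfolding of_nat_le_iff
    by (intro card_mono) (auto simp: Bad_def)
  also have "\<dots> \<le> real ((card V + 1) ^ s)"
    using card_bounded_subsets_le(2)[OF finite_V] by (rule of_nat_mono)
  also have "\<dots> = (real (card V) + 1) ^ s" by (simp add: add.commute)
  also have "\<dots> \<le> (z ^ (k + 3)) ^ s"
  proof (rule power_mono)
    have "1 \<le> z ^ (k + 2)" using z_ge_4 by (intro one_le_power) auto
    moreover have "4 * z ^ (k + 2) \<le> z * z ^ (k + 2)"
      using z_ge_4 by (intro mult_right_mono) auto
    moreover have "z ^ (k + 3) = z * z ^ (k + 2)" by (simp add: numeral_eq_Suc)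
    ultimately show "real (card V) + 1 \<le> z ^ (k + 3)" using cardV by linarith
  qed auto
  finally have cardBad: "real (card Bad) \<le> z ^ ((k + 3) * s)" by (simp add: power_mult)

  have "(\<Sum>ys\<in>Ys. nb ys) = (\<Sum>S\<in>Bad. real (card {ys \<in> Ys. S \<subseteq> pattern (set ys) {}}))"
    unfolding nb_def using fin by (rule sum_card_filter_swap)
  also have "\<dots> = (\<Sum>S\<in>Bad. real (card {ys \<in> Ys. set ys \<subseteq> pattern S {}}))"
    using swap by (intro sum.cong refl arg_cong[where f = "\<lambda>A. real (card A)"]) (auto simp: Bad_def)
  also have "\<dots> = (\<Sum>S\<in>Bad. real (card (pattern S {})) ^ t)"
    using card_lists[OF pattern_subset] by simp
  also have "\<dots> \<le> (\<Sum>S\<in>Bad. (z ^ M) ^ t)"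
    by (intro sum_mono power_mono) (auto simp: Bad_def)
  also have "\<dots> = card Bad * (z ^ M) ^ t" by simp
  also have "\<dots> \<le> z ^ ((k + 3) * s) * (z ^ M) ^ t"
    using cardBad z_ge_4 by (intro mult_right_mono) auto
  also have "\<dots> = z ^ ((k + 3) * s + M * (s + 1))"
    by (simp add: t_def power_add power_mult)
  finally have upper: "(\<Sum>ys\<in>Ys. nb ys) \<le> z ^ ((k + 3) * s + M * (s + 1))" .

  have "real (card Ys) = real (card V) ^ t"
    using card_lists[of V] by (simp add: Ys_def conj_ac cong: conj_cong)
  also have "\<dots> \<le> (z ^ (k + 2)) ^ t" using cardV by (intro power_mono) auto
  finally have cardYs: "real (card Ys) \<le> z ^ ((k + 2) * (s + 1))"
    unfolding t_def power_mult .

  \<comment> \<open>Averaging with weight \<open>z ^ (k + 2) \<ge> card V\<close> on each bad set: a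
    single bad set inside \<open>U\<close> would already outweigh \<open>card U\<close>, so the
    sequence found here admits none and no vertex of \<open>U\<close> has to be deleted.\<close>
  have "\<exists>ys\<in>Ys. z ^ (k + 2) * nb ys + z ^ M < card (pattern (set ys) {})"
  proof (rule ccontr)
    assume "\<not> ?thesis"
    then have "(\<Sum>ys\<in>Ys. real (card (pattern (set ys) {}))) \<le> (\<Sum>ys\<in>Ys. z ^ (k + 2) * nb ys + z ^ M)"
      by (intro sum_mono) (auto simp: not_less)
    also have "\<dots> = z ^ (k + 2) * (\<Sum>ys\<in>Ys. nb ys) + card Ys * z ^ M"
      by (simp add: sum.distrib sum_distrib_left)
    also have "\<dots> \<le> z ^ (k + 2) * z ^ ((k + 3) * s + M * (s + 1)) + z ^ ((k + 2) * (s + 1)) * z ^ M"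
      using upper cardYs z_ge_4 by (intro add_mono mult_left_mono mult_right_mono) auto
    also have "\<dots> = z ^ ((k + 2) + ((k + 3) * s + M * (s + 1))) + z ^ ((k + 2) * (s + 1) + M)"
      by (simp only: power_add)
    also have "\<dots> \<le> z ^ (k * (s + 2) - 1) + z ^ (k * (s + 2) - 1)"
    proof -
      have le_pred: "x \<le> y - 1" if "x + Suc c = y" for x y c :: nat
        using that by simp
      \<comment> \<open>The value of \<open>k\<close> comes from these identities: both error terms
        are smaller than \<open>z ^ (k * (s + 2))\<close> by a factor of at least
        \<open>z ^ 4\<close>.\<close>
      have "(k + 2) + ((k + 3) * s + M * (s + 1)) + Suc 3 = k * (s + 2)"
        "(k + 2) * (s + 1) + M + Suc (M * s + s + 3) = k * (s + 2)"
        by (auto simp: k_def algebra_simps)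
      from this[THEN le_pred] show ?thesis
        by (intro add_mono power_increasing) (use z_ge_4 in linarith)+
    qed
    also have "\<dots> < z * z ^ (k * (s + 2) - 1)"
    proof -
      have "0 < z ^ (k * (s + 2) - 1)" using z_ge_4 by simp
      moreover from this have "4 * z ^ (k * (s + 2) - 1) \<le> z * z ^ (k * (s + 2) - 1)"
        using z_ge_4 by (intro mult_right_mono) auto
      ultimately show ?thesis by linarith
    qed
    also have "\<dots> = z ^ (k * (s + 2))"
    proof -
      have "0 < k * (s + 2)" by (simp add: k_def)
      then show ?thesis unfolding mult.commute[of z] by (rule power_minus_mult)
    qed
    finally show False using lower by linarith
  qed
  then obtain ys where ys: "ys \<in> Ys" "z ^ (k + 2) * nb ys + z ^ M < card (pattern (set ys) {})"
    by blast
  let ?U = "pattern (set ys) {}"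
  have zM: "0 < z ^ M" "0 < z ^ (k + 2)" using z_ge_4 by auto
  have "nb ys = 0"
  proof (rule ccontr)
    assume "nb ys \<noteq> 0"
    then have "1 \<le> nb ys"
      unfolding nb_def real_of_nat_ge_one_iff of_nat_eq_0_iff by linarith
    then have "z ^ (k + 2) * 1 \<le> z ^ (k + 2) * nb ys"
      using zM by (intro mult_left_mono) auto
    moreover have "real (card ?U) \<le> card V"
      using card_mono[OF finite_V pattern_subset] by simp
    ultimately show False using ys(2) cardV zM by linarith
  qed
  then have noBad: "{S \<in> Bad. S \<subseteq> ?U} = {}"
    using fin by (simp add: nb_def)
  show ?thesis
  proof (intro exI[of _ ?U] conjI allI impI)
    show "z ^ M \<le> card ?U" using ys(2) \<open>nb ys = 0\<close> by simp
  next
    fix S assume "S \<subseteq> ?U" "card S \<le> s"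
    moreover have "?U \<subseteq> V" by (rule pattern_subset)
    ultimately show "z ^ M \<le> card (pattern S {})"
      using noBad by (force simp: Bad_def)
  qed (rule pattern_subset)
qed

section \<open>Realising all small adjacency patterns by many vertices\<close>

lemma card_pattern_insert_ge:
  assumes "x \<in> V" "x \<notin> crowded (pattern S T)"
  shows "card (pattern S T) / z\<^sup>2 \<le> card (pattern S (insert x T))"
proof -
  have "pattern S (insert x T) = {w \<in> pattern S T. {x, w} \<notin> E}"
    by (auto simp: pattern_def)
  then show ?thesis using assms by (simp add: crowded_def)
qed

text \<open>When the other values of \<open>f\<close> are fixed, fewer than \<open>z\<close> choices of \<open>f j\<close> are crowded for the
  pattern of \<open>f ` S\<close> and \<open>f ` T\<close>. A union bound over \<open>(S, T, j)\<close> is used because a greedy choice fails: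
  \<open>j\<close> may have to be chosen before the elements of \<open>S\<close>.\<close>

lemma exists_uncrowded_map:
  fixes M s r :: nat
  assumes "U \<subseteq> V" and U: "z ^ M \<le> card U" and M: "(3 * s + 4) * (2 * s + 1) + 2 \<le> M"
    and r: "real r + 1 \<le> z ^ (3 * s + 4)" "0 < r"
  shows "\<exists>f\<in>{..<r} \<rightarrow> U. \<forall>S T j. S \<subseteq> {..<r} \<longrightarrow> T \<subseteq> {..<r} \<longrightarrow> j \<in> {..<r} - (S \<union> T) \<longrightarrow>
           card S \<le> s \<longrightarrow> card T \<le> s \<longrightarrow> z\<^sup>2 \<le> card (pattern (f ` S) (f ` T)) \<longrightarrow>
           f j \<notin> crowded (pattern (f ` S) (f ` T))"
proof -
  let ?I = "{..<r}"
  let ?C = "{S. S \<subseteq> ?I \<and> card S \<le> s}"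
  define Tr where "Tr = {(S, T, j). S \<in> ?C \<and> T \<in> ?C \<and> j \<in> ?I - (S \<union> T)}"
  \<comment> \<open>\<open>card_crowded_less\<close> covers only patterns of size at least
    \<open>z\<^sup>2\<close>; the default \<open>{}\<close> makes the bound \<open>z\<close> hold
    for every \<open>f\<close>.\<close>
  define D where "D S T f = (if z\<^sup>2 \<le> card (pattern (f ` S) (f ` T))
      then crowded (pattern (f ` S) (f ` T)) else {})" for S T and f :: "nat \<Rightarrow> 'a"
  define Ev where "Ev = (\<lambda>(S, T, j). {f \<in> ?I \<rightarrow>\<^sub>E U. f j \<in> D S T f})"
  have finU: "finite U" using assms(1) finite_V finite_subset by blast
  have finC: "finite ?C" by (rule card_bounded_subsets_le) simp
  have TrC: "Tr \<subseteq> ?C \<times> ?C \<times> ?I" by (auto simp: Tr_def)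
  have finTr: "finite Tr" by (rule finite_subset[OF TrC]) (use finC in auto)
  have u_pos: "0 < real (card U)"
    using U z_ge_4 by (intro less_le_trans[OF _ U]) auto
  have "real (card (Ev \<tau>)) \<le> z * card U ^ (r - 1)" if \<tau>_Tr: "\<tau> \<in> Tr" for \<tau>
  proof -
    obtain S T j where \<tau>: "\<tau> = (S, T, j)" "j \<in> ?I" "j \<notin> S" "j \<notin> T"
      by (cases \<tau>) (use \<tau>_Tr in \<open>auto simp: Tr_def\<close>)
    \<comment> \<open>As \<open>j\<close> lies outside \<open>S\<close> and \<open>T\<close>, the
      set \<open>D S T f\<close> does not depend on \<open>f j\<close>, which
      \<open>card_PiE_hit_le\<close> requires.\<close>
    have upd: "f(j := x) ` S = f ` S" "f(j := x) ` T = f ` T" for f :: "nat \<Rightarrow> 'a" and x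
      by ((rule image_cong, rule refl, use \<tau> in force)+)
    have "real (card (D S T f \<inter> U)) \<le> z" for f
    proof (cases "z\<^sup>2 \<le> card (pattern (f ` S) (f ` T))")
      case True
      have "card (D S T f \<inter> U) \<le> card (crowded (pattern (f ` S) (f ` T)))"
        using True finite_V by (intro card_mono) (auto simp: D_def crowded_def)
      then show ?thesis using card_crowded_less[OF pattern_subset True] by linarith
    next
      case False
      then show ?thesis using z_ge_4 by (simp add: D_def)
    qed
    then have "real (card {f \<in> ?I \<rightarrow>\<^sub>E U. f j \<in> D S T f}) \<le> z * card U ^ (card ?I - 1)"
      using finU \<tau>(2) by (intro card_PiE_hit_le) (simp_all only: D_def upd finite_lessThan)
    then show ?thesis by (simp add: \<tau> Ev_def)
  qed
  then have "(\<Sum>\<tau>\<in>Tr. real (card (Ev \<tau>))) \<le> (\<Sum>\<tau>\<in>Tr. z * card U ^ (r - 1))"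
    by (rule sum_mono)
  moreover have "real (card (\<Union>\<tau>\<in>Tr. Ev \<tau>)) \<le> (\<Sum>\<tau>\<in>Tr. real (card (Ev \<tau>)))"
    using finTr by (rule real_card_UN_le)
  ultimately have "real (card (\<Union>\<tau>\<in>Tr. Ev \<tau>)) \<le> card Tr * (z * card U ^ (r - 1))"
    by simp
  also have "\<dots> \<le> z ^ ((3 * s + 4) * (2 * s + 1)) * (z * card U ^ (r - 1))"
  proof (rule mult_right_mono)
    have "card Tr \<le> card (?C \<times> ?C \<times> ?I)"
      using TrC finC by (intro card_mono) auto
    also have "\<dots> = card ?C * card ?C * r" by (simp add: card_cartesian_product)
    also have "\<dots> \<le> (r + 1) ^ s * (r + 1) ^ s * (r + 1)"
      using card_bounded_subsets_le(2)[of ?I s] by (intro mult_mono) auto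
    also have "\<dots> = (r + 1) ^ (2 * s + 1)" by (simp add: mult_2 power_add)
    finally have "real (card Tr) \<le> (real r + 1) ^ (2 * s + 1)"
      by (metis of_nat_1 of_nat_add of_nat_mono of_nat_power)
    also have "\<dots> \<le> (z ^ (3 * s + 4)) ^ (2 * s + 1)"
      using r by (intro power_mono) auto
    finally show "real (card Tr) \<le> z ^ ((3 * s + 4) * (2 * s + 1))"
      by (simp only: power_mult)
  qed (use z_ge_4 in auto)
  also have "\<dots> = z ^ ((3 * s + 4) * (2 * s + 1) + 1) * card U ^ (r - 1)"
    by (simp only: power_add power_one_right mult.assoc)
  \<comment> \<open>Origin of the bound on \<open>M\<close>: the product bounds the number of
    triples, one more factor \<open>z\<close> the crowded values, and another makes the inequality
    strict.\<close>
  also have "\<dots> < real (card U) * real (card U ^ (r - 1))"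
  proof (rule mult_strict_right_mono)
    have "z ^ ((3 * s + 4) * (2 * s + 1) + 1) < z ^ M"
      using M z_ge_4 by (intro power_strict_increasing) auto
    then show "z ^ ((3 * s + 4) * (2 * s + 1) + 1) < card U" using U by linarith
  qed (use u_pos in auto)
  also have "\<dots> = real (card (?I \<rightarrow>\<^sub>E U))"
    using r(2) by (simp add: card_PiE power_eq_if)
  finally have "card (\<Union>\<tau>\<in>Tr. Ev \<tau>) < card (?I \<rightarrow>\<^sub>E U)" by simp
  moreover have "finite (\<Union>\<tau>\<in>Tr. Ev \<tau>)"
    by (rule finite_subset[of _ "?I \<rightarrow>\<^sub>E U"]) (use finU in \<open>auto simp: Ev_def intro: finite_PiE\<close>)
  ultimately have "\<not> (?I \<rightarrow>\<^sub>E U) \<subseteq> (\<Union>\<tau>\<in>Tr. Ev \<tau>)"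
    using card_mono leD by blast
  then obtain f where f: "f \<in> ?I \<rightarrow>\<^sub>E U" "\<And>\<tau>. \<tau> \<in> Tr \<Longrightarrow> f \<notin> Ev \<tau>" by blast
  show ?thesis
  proof (intro bexI[of _ f] allI impI)
    fix S T j
    assume *: "S \<subseteq> ?I" "T \<subseteq> ?I" "j \<in> ?I - (S \<union> T)" "card S \<le> s" "card T \<le> s"
      "z\<^sup>2 \<le> card (pattern (f ` S) (f ` T))"
    then have "(S, T, j) \<in> Tr" by (simp add: Tr_def)
    from f(2)[OF this] show "f j \<notin> crowded (pattern (f ` S) (f ` T))"
      using f(1) * by (simp add: Ev_def D_def)
  qed (use f in auto)
qed

text \<open>Each vertex added to \<open>T\<close> is uncrowded for the current pattern and costs a
  factor \<open>z\<^sup>2\<close>, so at most \<open>s\<close> of them lower the exponent by at most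
  \<open>2 * s\<close>. The size of \<open>R\<close> is what \<open>independent_transversal\<close>
  asks for when placing up to \<open>s\<close> vertices.\<close>

lemma exists_rich_set:
  fixes M s :: nat
  assumes "1 \<le> s" "U \<subseteq> V" "z ^ M \<le> card U"
    and M: "(3 * s + 4) * (2 * s + 1) + 2 \<le> M"
    and common: "\<And>S. S \<subseteq> U \<Longrightarrow> card S \<le> s \<Longrightarrow> z ^ M \<le> card (pattern S {})"
  shows "\<exists>R\<subseteq>U. z ^ (3 * (s + 1)) \<le> card R \<and>
           (\<forall>S T. S \<subseteq> R \<longrightarrow> T \<subseteq> R \<longrightarrow> S \<inter> T = {} \<longrightarrow> card S \<le> s \<longrightarrow> card T \<le> s \<longrightarrow>
             z ^ (M - 2 * s) \<le> card (pattern S T))"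
proof -
  define r where "r = nat \<lceil>z ^ (3 * s + 3)\<rceil>"
  let ?I = "{..<r}"
  have one: "1 \<le> z ^ (3 * s + 3)" using z_ge_4 by (intro one_le_power) auto
  have r: "z ^ (3 * s + 3) \<le> r" "real r \<le> z ^ (3 * s + 3) + 1"
    using one unfolding r_def by linarith+
  have "z ^ (3 * s + 4) = z * z ^ (3 * s + 3)" by (simp add: numeral_eq_Suc)
  moreover have "4 * z ^ (3 * s + 3) \<le> z * z ^ (3 * s + 3)"
    using z_ge_4 by (intro mult_right_mono) auto
  ultimately have r2: "real r + 1 \<le> z ^ (3 * s + 4)" using r one by linarith
  have r_pos: "0 < r" using r one by linarith
  have M': "2 * s + 2 \<le> M"
  proof -
    have "2 * s + 2 \<le> (3 * s + 4) * (2 * s + 1) + 2" by simp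
    then show ?thesis using M by (rule order_trans)
  qed
  obtain f where f: "f \<in> ?I \<rightarrow> U"
    and uncrowded: "\<And>S T j. \<lbrakk>S \<subseteq> ?I; T \<subseteq> ?I; j \<in> ?I - (S \<union> T); card S \<le> s; card T \<le> s;
      z\<^sup>2 \<le> card (pattern (f ` S) (f ` T))\<rbrakk> \<Longrightarrow> f j \<notin> crowded (pattern (f ` S) (f ` T))"
    using exists_uncrowded_map[OF assms(2,3) M r2 r_pos] by blast
  have rich: "z ^ (M - 2 * card T) \<le> card (pattern (f ` S) (f ` T))"
    if "finite T" "T \<subseteq> ?I" "S \<subseteq> ?I" "S \<inter> T = {}" "card S \<le> s" "card T \<le> s" for S T
    using that
  proof (induction T rule: finite_induct)
    case empty
    have "card (f ` S) \<le> s"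
      using card_image_le[of S f] finite_subset[OF empty(2)] empty by simp
    moreover have "f ` S \<subseteq> U" using f empty by auto
    ultimately show ?case using common by simp
  next
    case (insert j T)
    have ih: "z ^ (M - 2 * card T) \<le> card (pattern (f ` S) (f ` T))"
      using insert by auto
    have cT: "card T + 1 \<le> s" using insert by simp
    have "z\<^sup>2 \<le> z ^ (M - 2 * card T)"
      using z_ge_4 cT M' by (intro power_increasing) auto
    then have "f j \<notin> crowded (pattern (f ` S) (f ` T))"
      using insert ih by (intro uncrowded) auto
    moreover have "f j \<in> V" using f insert.prems assms(2) by auto
    ultimately have "card (pattern (f ` S) (f ` T)) / z\<^sup>2 \<le> card (pattern (f ` S) (f ` insert j T))"
      using card_pattern_insert_ge by simp
    moreover have "z ^ (M - 2 * card T) / z\<^sup>2 \<le> card (pattern (f ` S) (f ` T)) / z\<^sup>2"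
      using ih by (intro divide_right_mono) auto
    moreover have "z ^ (M - 2 * card T) / z\<^sup>2 = z ^ (M - 2 * card (insert j T))"
    proof -
      have "M - 2 * card T = (M - 2 * card (insert j T)) + 2"
        using insert.hyps cT M' by simp
      then have "z ^ (M - 2 * card T) = z ^ (M - 2 * card (insert j T)) * z\<^sup>2"
        by (simp only: power_add)
      then show ?thesis using z_ge_4 by simp
    qed
    ultimately show ?case by linarith
  qed
  \<comment> \<open>Injectivity follows from richness: if \<open>f i = f j\<close>, no vertex is
    adjacent to \<open>f i\<close> and non-adjacent to \<open>f j\<close>.\<close>
  have inj: "inj_on f ?I"
  proof (rule inj_onI, rule ccontr)
    fix i j assume ij: "i \<in> ?I" "j \<in> ?I" "f i = f j" "i \<noteq> j"
    have "z ^ (M - 2 * card {j}) \<le> card (pattern (f ` {i}) (f ` {j}))"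
      using ij assms(1) by (intro rich) auto
    moreover have "pattern (f ` {i}) (f ` {j}) = {}" using ij by (auto simp: pattern_def)
    moreover have "0 < z ^ (M - 2 * card {j})" using z_ge_4 by simp
    ultimately show False by simp
  qed
  show ?thesis
  proof (intro exI[of _ "f ` ?I"] conjI allI impI)
    show "f ` ?I \<subseteq> U" using f by auto
    show "z ^ (3 * (s + 1)) \<le> card (f ` ?I)"
      using r inj by (simp add: card_image algebra_simps)
  next
    fix S T assume *: "S \<subseteq> f ` ?I" "T \<subseteq> f ` ?I" "S \<inter> T = {}" "card S \<le> s" "card T \<le> s"
    obtain S' T' where ST: "S' \<subseteq> ?I" "S = f ` S'" "T' \<subseteq> ?I" "T = f ` T'"
      using *(1,2) unfolding subset_image_iff by blast
    have card_eq: "card S = card S'" "card T = card T'"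
      using ST inj by (metis card_image inj_on_subset)+
    have "z ^ (M - 2 * s) \<le> z ^ (M - 2 * card T')"
      using z_ge_4 * card_eq by (intro power_increasing) auto
    also have "\<dots> \<le> card (pattern S T)"
      unfolding ST using * ST card_eq finite_subset[OF ST(3)] by (intro rich) auto
    finally show "z ^ (M - 2 * s) \<le> card (pattern S T)" .
  qed
qed

section \<open>Embedding a bipartite graph as an induced subgraph\<close>

text \<open>\<open>A\<close> is placed by an independent transversal whose sets all equal a rich set
  \<open>R\<close>. Each \<open>b\<close> is then confined to the vertices with the adjacencies to
  the image of \<open>A\<close> that \<open>adj\<close> prescribes, and a second transversal makes
  the image of \<open>B\<close> independent.\<close>

lemma induced_bipartite_embedding:
  fixes A B :: "'b set" and M s :: nat and adj :: "'b \<Rightarrow> 'b \<Rightarrow> bool"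
  defines "k \<equiv> M * s + M + 3 * s + 6"
  assumes AB: "finite A" "finite B" "A \<inter> B = {}"
    and s: "1 \<le> s" "card A \<le> s" "s \<le> z" and B: "card B \<le> z"
    and M: "(3 * s + 4) * (2 * s + 1) + 2 \<le> M" "2 * s + 3 * card B + 4 \<le> M"
    and large: "card V \<le> z ^ (k + 2)" "z ^ (2 * k + 3) \<le> card E"
  shows "\<exists>h. inj_on h (A \<union> B) \<and> h ` (A \<union> B) \<subseteq> V \<and>
           (\<forall>a\<in>A. \<forall>b\<in>B. {h a, h b} \<in> E \<longleftrightarrow> adj a b) \<and>
           (\<forall>a\<in>A. \<forall>a'\<in>A. {h a, h a'} \<notin> E) \<and> (\<forall>b\<in>B. \<forall>b'\<in>B. {h b, h b'} \<notin> E)"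
proof -
  have noloop: "{x, x} \<notin> E" for x
    using E_subset by (auto simp: nsets_def)
  obtain U where U: "U \<subseteq> V" "z ^ M \<le> card U"
      "\<And>S. S \<subseteq> U \<Longrightarrow> card S \<le> s \<Longrightarrow> z ^ M \<le> card (pattern S {})"
    using dependent_random_choice[OF large[unfolded k_def]] by blast
  obtain R where R: "R \<subseteq> U" "z ^ (3 * (s + 1)) \<le> card R"
    and rich: "\<And>S T. \<lbrakk>S \<subseteq> R; T \<subseteq> R; S \<inter> T = {}; card S \<le> s; card T \<le> s\<rbrakk> \<Longrightarrow>
        z ^ (M - 2 * s) \<le> card (pattern S T)"
    using exists_rich_set[OF s(1) U(1,2) M(1) U(3)] by blast
  have "z ^ (3 * (card A + 1)) \<le> z ^ (3 * (s + 1))"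
    using s z_ge_4 by (intro power_increasing) auto
  then have "\<exists>g. (\<forall>a\<in>A. g a \<in> R) \<and> (\<forall>a\<in>A. \<forall>a'\<in>A. a \<noteq> a' \<longrightarrow> g a \<noteq> g a' \<and> {g a, g a'} \<notin> E)"
    using s R U(1) by (intro independent_transversal AB(1)) auto
  then obtain g where g: "\<forall>a\<in>A. g a \<in> R"
    and g_ind: "\<forall>a\<in>A. \<forall>a'\<in>A. a \<noteq> a' \<longrightarrow> g a \<noteq> g a' \<and> {g a, g a'} \<notin> E"
    by (elim exE conjE)
  \<comment> \<open>The image of \<open>A\<close> is removed because a pattern may contain the
    vertices of its own second argument, which would spoil injectivity of \<open>h\<close>.\<close>
  define Y where
    "Y b = pattern (g ` {a \<in> A. adj a b}) (g ` {a \<in> A. \<not> adj a b}) - g ` A" for b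
  have Y: "Y b \<subseteq> V \<and> z ^ (3 * (card B + 1)) \<le> card (Y b)" for b
  proof
    show "Y b \<subseteq> V" using pattern_subset by (auto simp: Y_def)
    let ?S = "g ` {a \<in> A. adj a b}" and ?T = "g ` {a \<in> A. \<not> adj a b}"
    have card_le: "card (g ` A') \<le> s" if "A' \<subseteq> A" for A'
      using card_image_le[OF finite_subset[OF that AB(1)], of g] card_mono[OF AB(1) that] s(2)
      by linarith
    have "?S \<inter> ?T = {}" using g_ind by fastforce
    then have "z ^ (M - 2 * s) \<le> card (pattern ?S ?T)"
      using g card_le by (intro rich) auto
    moreover have "real (card (pattern ?S ?T)) \<le> card (Y b) + z"
    proof -
      have "card (pattern ?S ?T) \<le> card (Y b) + card (g ` A)"
        unfolding Y_def using diff_card_le_card_Diff[of "g ` A" "pattern ?S ?T"] AB(1) by simp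
      then show ?thesis using card_le[of A] s(3) by simp
    qed
    \<comment> \<open>Of the exponent \<open>M\<close>, \<open>2 * s\<close> went into the patterns
      and \<open>3 * card B + 3\<close> serves the transversal over \<open>B\<close>; the remaining
      factor \<open>z\<close> pays for removing the image of \<open>A\<close>.\<close>
    moreover have "z ^ (3 * card B + 4) \<le> z ^ (M - 2 * s)"
      using M(2) z_ge_4 by (intro power_increasing) auto
    moreover have "z ^ (3 * card B + 4) = z * z ^ (3 * card B + 3)"
      by (simp add: numeral_eq_Suc)
    moreover have "4 * z ^ (3 * card B + 3) \<le> z * z ^ (3 * card B + 3)"
      using z_ge_4 by (intro mult_right_mono) auto
    moreover have "z \<le> z ^ (3 * card B + 3)"
      using power_increasing[of 1 "3 * card B + 3" z] z_ge_4 by simp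
    ultimately have "z ^ (3 * card B + 3) \<le> card (Y b)" using z_ge_4 by linarith
    then show "z ^ (3 * (card B + 1)) \<le> card (Y b)" by (simp add: algebra_simps)
  qed
  obtain g' where g': "\<forall>b\<in>B. g' b \<in> Y b"
    and g'_ind: "\<forall>b\<in>B. \<forall>b'\<in>B. b \<noteq> b' \<longrightarrow> g' b \<noteq> g' b' \<and> {g' b, g' b'} \<notin> E"
    using independent_transversal[of B Y, OF AB(2) B Y] by (elim exE conjE)
  define h where "h x = (if x \<in> A then g x else g' x)" for x
  have hA: "h a = g a" if "a \<in> A" for a using that by (simp add: h_def)
  have hB: "h b = g' b" if "b \<in> B" for b using that AB(3) by (auto simp: h_def)
  have cross: "g a \<noteq> g' b" if "a \<in> A" "b \<in> B" for a b
    using bspec[OF g' that(2)] imageI[OF that(1), of g] unfolding Y_def by (metis DiffD2)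
  show ?thesis
  proof (intro exI[of _ h] conjI ballI)
    show "inj_on h (A \<union> B)"
    proof (rule inj_onI)
      fix x y assume "x \<in> A \<union> B" "y \<in> A \<union> B" "h x = h y"
      then show "x = y"
        using g_ind g'_ind cross by (auto simp: hA hB) metis+
    qed
    have "g a \<in> V" if "a \<in> A" for a using g that R(1) U(1) by auto
    moreover have "g' b \<in> V" if "b \<in> B" for b using g' that Y by blast
    ultimately show "h ` (A \<union> B) \<subseteq> V" by (auto simp: hA hB)
  next
    fix a b assume ab: "a \<in> A" "b \<in> B"
    then show "({h a, h b} \<in> E) = adj a b"
      using bspec[OF g' ab(2)] by (auto simp: hA hB Y_def pattern_def)
  next
    fix a a' assume "a \<in> A" "a' \<in> A"
    then show "{h a, h a'} \<notin> E" using g_ind noloop by (cases "a = a'") (auto simp: hA)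
  next
    fix b b' assume "b \<in> B" "b' \<in> B"
    then show "{h b, h b'} \<notin> E" using g'_ind noloop by (cases "b = b'") (auto simp: hB)
  qed
qed

end

section \<open>Subgraphs of a biclique-free graph\<close>

lemma isomorphic_induced_image:
  assumes inj: "inj_on h (verts L)"
    and edge_iff: "\<And>u v. u \<in> verts L \<Longrightarrow> v \<in> verts L \<Longrightarrow> {h u, h v} \<in> edges H \<longleftrightarrow> {u, v} \<in> edges L"
  shows "isomorphic (induced H (h ` verts L)) L"
proof -
  have "bij_betw (inv_into (verts L) h) (h ` verts L) (verts L)"
    using inj by (intro bij_betw_inv_into inj_on_imp_bij_betw)
  then show ?thesis
    unfolding isomorphic_def induced_def
    using inj edge_iff by (auto intro!: exI[of _ "inv_into (verts L) h"])
qed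

text \<open>A member \<open>H\<close> of \<open>P\<close> attaining the maximum inherits the absence
  of bicliques from \<open>G\<close>. With more than \<open>z ^ (2 * k + 3)\<close> edges it would
  contain \<open>L\<close> as an induced subgraph, and heredity would put \<open>L\<close> into
  \<open>P\<close>.\<close>

lemma ex_num_le_if_no_biclique:
  fixes L G :: "'a ugraph" and M s :: nat and z :: real
  defines "k \<equiv> M * s + M + 3 * s + 6"
  assumes L: "finite_graph L" "A \<union> B = verts L" "A \<inter> B = {}"
      "\<forall>e\<in>edges L. \<exists>a\<in>A. \<exists>b\<in>B. e = {a, b}"
    and P: "hereditary_property P" "L \<notin> P"
    and G: "finite_graph G" "card (verts G) \<le> z ^ (k + 2)"
    and z: "4 \<le> z" "s \<le> z" "card B \<le> z"
    and s: "1 \<le> s" "card A \<le> s"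
    and M: "(3 * s + 4) * (2 * s + 1) + 2 \<le> M" "2 * s + 3 * card B + 4 \<le> M"
    and no_biclique: "\<And>X Y. \<lbrakk>X \<subseteq> verts G; Y \<subseteq> verts G; X \<inter> Y = {};
      card X = nat \<lceil>z\<rceil>; card Y = nat \<lceil>z\<rceil>\<rbrakk> \<Longrightarrow> \<exists>x\<in>X. \<exists>y\<in>Y. {x, y} \<notin> edges G"
  shows "ex_num G P \<le> z ^ (2 * k + 3)"
proof (rule ccontr)
  assume large: "\<not> ?thesis"
  have "ex_num G P \<in> {card (edges H) | H. subgraph H G \<and> H \<in> P}"
    unfolding ex_num_def using ex_num_set_finite_nonempty[OF G(1) P(1)] by (rule Max_in)
  then obtain H where H: "ex_num G P = card (edges H)" "subgraph H G" "H \<in> P" by blast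
  have HG: "verts H \<subseteq> verts G" "edges H \<subseteq> edges G" and
    H_graph: "finite (verts H)" "edges H \<subseteq> nsets (verts H) 2"
    using H(2) by (auto simp: subgraph_def finite_graph_def)
  have finG: "finite (verts G)" using G(1) by (simp add: finite_graph_def)
  interpret biclique_free "verts H" "edges H" z
  proof
    \<comment> \<open>The hypothesis on \<open>G\<close> concerns disjoint sets of one fixed size,
      as suits a union bound. The locale asks for all sizes from \<open>z\<close> on, so overlaps
      are excluded and the sets shrunk.\<close>
    fix X Y assume XY: "X \<subseteq> verts H" "Y \<subseteq> verts H" "z \<le> card X" "z \<le> card Y"
    show "\<exists>x\<in>X. \<exists>y\<in>Y. {x, y} \<notin> edges H"
    proof (rule ccontr)
      assume "\<not> ?thesis"
      then have complete: "\<And>x y. x \<in> X \<Longrightarrow> y \<in> Y \<Longrightarrow> {x, y} \<in> edges H" by blast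
      have disj: "X \<inter> Y = {}"
      proof (rule ccontr)
        assume "X \<inter> Y \<noteq> {}"
        then obtain x where "{x, x} \<in> edges H" using complete by blast
        then show False using H_graph by (auto simp: nsets_def)
      qed
      have "nat \<lceil>z\<rceil> \<le> card X" "nat \<lceil>z\<rceil> \<le> card Y" using XY by linarith+
      then obtain X' Y' where "X' \<subseteq> X" "card X' = nat \<lceil>z\<rceil>" "Y' \<subseteq> Y" "card Y' = nat \<lceil>z\<rceil>"
        by (metis obtain_subset_with_card_n)
      moreover from this obtain x y where "x \<in> X'" "y \<in> Y'" "{x, y} \<notin> edges G"
        using no_biclique[of X' Y'] XY HG disj by blast
      ultimately show False using complete HG by blast
    qed
  qed (use H_graph z in auto)
  have "card (verts H) \<le> z ^ (k + 2)"
    using card_mono[OF finG HG(1)] G(2) by linarith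
  moreover have "z ^ (2 * k + 3) \<le> card (edges H)" using large H(1) by simp
  moreover have "finite (A \<union> B)" using L(1,2) by (simp add: finite_graph_def)
  ultimately obtain h where h: "inj_on h (A \<union> B)" "h ` (A \<union> B) \<subseteq> verts H"
      "\<forall>a\<in>A. \<forall>b\<in>B. {h a, h b} \<in> edges H \<longleftrightarrow> {a, b} \<in> edges L"
      "\<forall>a\<in>A. \<forall>a'\<in>A. {h a, h a'} \<notin> edges H" "\<forall>b\<in>B. \<forall>b'\<in>B. {h b, h b'} \<notin> edges H"
    using induced_bipartite_embedding[of A B s M "\<lambda>a b. {a, b} \<in> edges L"] L(3) s z M
    unfolding k_def by auto
  have no_inner: "{a, a'} \<notin> edges L" if "a \<in> A \<and> a' \<in> A \<or> a \<in> B \<and> a' \<in> B" for a a'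
    using L(3,4) that by (fastforce simp: doubleton_eq_iff)
  have "isomorphic (induced H (h ` verts L)) L"
  proof (rule isomorphic_induced_image)
    fix u v assume "u \<in> verts L" "v \<in> verts L"
    then consider "u \<in> A" "v \<in> B" | "u \<in> B" "v \<in> A" | "u \<in> A \<and> v \<in> A" | "u \<in> B \<and> v \<in> B"
      unfolding L(2)[symmetric] by blast
    then show "{h u, h v} \<in> edges H \<longleftrightarrow> {u, v} \<in> edges L"
    proof cases
      case 2
      then show ?thesis using bspec[OF bspec[OF h(3)], of v u] by (metis insert_commute)
    qed (use h no_inner in auto)
  qed (use h(1) L(2) in simp)
  moreover have "induced H (h ` verts L) \<in> P"
    using P(1) H(3) h(2) unfolding hereditary_property_def L(2) by blast
  ultimately show False
    using P L(1) unfolding hereditary_property_def by blast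
qed

section \<open>Bicliques in the random graph\<close>

text \<open>The event is a product set: coordinates in \<open>F\<close> are forced to be true, all
  others are free.\<close>

lemma prob_gnp_contains_edges:
  assumes "F \<subseteq> nsets {1..n} 2" "0 \<le> p" "p \<le> 1"
  shows "measure_pmf.prob (gnp n p) {G. F \<subseteq> edges G} = p ^ card F"
proof -
  let ?E = "nsets {1..n} 2"
  have fin: "finite ?E" by (intro finite_imp_finite_nsets) simp
  have "(\<lambda>X. ({1..n}, {e \<in> ?E. X e})) -` {G. F \<subseteq> edges G}
      = Pi ?E (\<lambda>e. if e \<in> F then {True} else UNIV)"
    using assms(1) by (auto simp: Pi_def split: if_splits)
  then have "measure_pmf.prob (gnp n p) {G. F \<subseteq> edges G}
      = (\<Prod>e\<in>?E. measure_pmf.prob (bernoulli_pmf p) (if e \<in> F then {True} else UNIV))"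
    unfolding gnp_def measure_map_pmf by (simp only: measure_Pi_pmf_Pi[OF fin])
  also have "\<dots> = (\<Prod>e\<in>?E. if e \<in> F then p else 1)"
    using assms(2,3) by (intro prod.cong) (auto simp: measure_pmf_single)
  also have "\<dots> = p ^ card F"
    using fin assms(1) by (simp add: prod.If_cases Int_absorb1)
  finally show ?thesis .
qed

text \<open>Disjointness makes the \<open>a * a\<close> pairs \<open>{x, y}\<close> distinct
  two-element sets, so a given biclique is present with probability
  \<open>p ^ (a * a)\<close>.\<close>

definition has_biclique :: "nat \<Rightarrow> nat \<Rightarrow> nat ugraph \<Rightarrow> bool" where
  "has_biclique n a G \<longleftrightarrow> (\<exists>X Y. X \<subseteq> {1..n} \<and> Y \<subseteq> {1..n} \<and> X \<inter> Y = {} \<and>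
     card X = a \<and> card Y = a \<and> (\<forall>x\<in>X. \<forall>y\<in>Y. {x, y} \<in> edges G))"

lemma no_bicliqueD:
  assumes "\<not> has_biclique n a G" "X \<subseteq> {1..n}" "Y \<subseteq> {1..n}" "X \<inter> Y = {}" "card X = a" "card Y = a"
  shows "\<exists>x\<in>X. \<exists>y\<in>Y. {x, y} \<notin> edges G"
proof (rule ccontr)
  assume "\<not> ?thesis"
  then have "\<forall>x\<in>X. \<forall>y\<in>Y. {x, y} \<in> edges G" by simp
  with assms(2-) have "has_biclique n a G"
    unfolding has_biclique_def by (intro exI conjI)
  with assms(1) show False by contradiction
qed

text \<open>Union bound over at most \<open>n ^ a * n ^ a\<close> pairs of sets.\<close>

lemma prob_gnp_has_biclique_le:
  assumes "0 \<le> p" "p \<le> 1"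
  shows "measure_pmf.prob (gnp n p) {G. has_biclique n a G} \<le> ((real n)\<^sup>2 * p ^ a) ^ a"
proof -
  let ?C = "{X. X \<subseteq> {1..n} \<and> card X = a}"
  define Pairs where "Pairs = {(X, Y). X \<in> ?C \<and> Y \<in> ?C \<and> X \<inter> Y = {}}"
  define F where "F = (\<lambda>(X, Y). (\<lambda>(x, y). {x, y}) ` (X \<times> Y) :: nat set set)"
  have finC: "finite ?C" by simp
  have PC: "Pairs \<subseteq> ?C \<times> ?C" by (auto simp: Pairs_def)
  have finP: "finite Pairs" using finite_subset[OF PC] finC by blast
  have prob_F: "measure_pmf.prob (gnp n p) {G. F \<pi> \<subseteq> edges G} = p ^ (a * a)" if "\<pi> \<in> Pairs" for \<pi>
  proof -
    obtain X Y where \<pi>: "\<pi> = (X, Y)" "X \<subseteq> {1..n}" "card X = a" "Y \<subseteq> {1..n}" "card Y = a" "X \<inter> Y = {}"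
      by (cases \<pi>) (use \<open>\<pi> \<in> Pairs\<close> in \<open>auto simp: Pairs_def\<close>)
    have "inj_on (\<lambda>(x, y). {x, y}) (X \<times> Y)"
      using \<pi>(6) by (auto simp: inj_on_def doubleton_eq_iff)
    then have "card (F \<pi>) = a * a"
      unfolding F_def \<pi>(1) using \<pi> by (simp add: card_image card_cartesian_product)
    moreover have "F \<pi> \<subseteq> nsets {1..n} 2"
      using \<pi> by (auto simp: F_def doubleton_in_nsets_2 disjoint_iff simp del: atLeastAtMost_iff)
    ultimately show ?thesis using prob_gnp_contains_edges[of "F \<pi>" n p] assms by simp
  qed
  have cardC: "card ?C \<le> n ^ a"
  proof -
    have "card ?C = n choose a" using n_subsets[of "{1..n}" a] by simp
    also have "\<dots> \<le> n ^ a"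
      by (cases "a \<le> n") (simp_all add: binomial_le_pow binomial_eq_0)
    finally show ?thesis .
  qed
  have "card (?C \<times> ?C) \<le> n ^ a * n ^ a"
    unfolding card_cartesian_product by (rule mult_le_mono[OF cardC cardC])
  then have "card Pairs \<le> n ^ a * n ^ a"
    using card_mono[OF finite_cartesian_product[OF finC finC] PC] by (rule order_trans[rotated])
  then have cardP: "real (card Pairs) \<le> real n ^ a * real n ^ a"
    unfolding of_nat_power[symmetric] of_nat_mult[symmetric] of_nat_le_iff .
  have "{G. has_biclique n a G} \<subseteq> (\<Union>\<pi>\<in>Pairs. {G. F \<pi> \<subseteq> edges G})"
  proof
    fix G assume "G \<in> {G. has_biclique n a G}"
    then obtain X Y where "(X, Y) \<in> Pairs" "\<forall>x\<in>X. \<forall>y\<in>Y. {x, y} \<in> edges G"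
      by (auto simp: has_biclique_def Pairs_def)
    then show "G \<in> (\<Union>\<pi>\<in>Pairs. {G. F \<pi> \<subseteq> edges G})"
      by (intro UN_I[of "(X, Y)"]) (auto simp: F_def)
  qed
  then have "measure_pmf.prob (gnp n p) {G. has_biclique n a G}
      \<le> measure_pmf.prob (gnp n p) (\<Union>\<pi>\<in>Pairs. {G. F \<pi> \<subseteq> edges G})"
    by (intro measure_pmf.finite_measure_mono) auto
  also have "\<dots> \<le> (\<Sum>\<pi>\<in>Pairs. measure_pmf.prob (gnp n p) {G. F \<pi> \<subseteq> edges G})"
    using finP by (intro measure_pmf.finite_measure_subadditive_finite) auto
  also have "\<dots> = card Pairs * p ^ (a * a)" using prob_F by simp
  also have "\<dots> \<le> real n ^ a * real n ^ a * p ^ (a * a)"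
    using cardP assms by (intro mult_right_mono) auto
  also have "\<dots> = ((real n)\<^sup>2 * p ^ a) ^ a"
    by (simp add: power_mult power_mult_distrib power2_eq_square)
  finally show ?thesis .
qed

text \<open>For \<open>a \<ge> n powr \<delta>\<close>, the decay of \<open>p ^ a\<close> beats the
  factor \<open>n\<^sup>2\<close>.\<close>

lemma prob_gnp_no_biclique_tendsto_1:
  fixes p \<delta> :: real
  assumes "0 < p" "p < 1" "0 < \<delta>"
  shows "(\<lambda>n. measure_pmf.prob (gnp n p) {G. \<not> has_biclique n (nat \<lceil>real n powr \<delta>\<rceil>) G}) \<longlonglongrightarrow> 1"
proof -
  define c where "c = - ln p"
  have c: "c > 0" using assms by (simp add: c_def)
  define f where "f n = (real n)\<^sup>2 * exp (- c * real n powr \<delta>)" for n :: nat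
  have f0: "f \<longlonglongrightarrow> 0"
    unfolding f_def using c assms(3) by real_asymp
  then have "\<forall>\<^sub>F n in sequentially. f n < 1" by (rule order_tendstoD) simp
  moreover have "\<forall>\<^sub>F n in sequentially. n \<ge> (1::nat)" by (rule eventually_ge_at_top)
  ultimately have lower: "\<forall>\<^sub>F n in sequentially.
      1 - f n \<le> measure_pmf.prob (gnp n p) {G. \<not> has_biclique n (nat \<lceil>real n powr \<delta>\<rceil>) G}"
  proof eventually_elim
    case (elim n)
    let ?z = "real n powr \<delta>"
    let ?a = "nat \<lceil>?z\<rceil>"
    have "0 < ?z" using elim by simp
    then have a: "1 \<le> ?a" "?z \<le> ?a" by linarith+
    have "p ^ ?a = exp (- c * ?a)"
      unfolding exp_of_nat2_mult c_def using assms(1) by simp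
    also have "\<dots> \<le> exp (- c * ?z)" using a c by simp
    finally have le: "(real n)\<^sup>2 * p ^ ?a \<le> f n"
      unfolding f_def by (intro mult_left_mono) auto
    have "measure_pmf.prob (gnp n p) {G. has_biclique n ?a G} \<le> ((real n)\<^sup>2 * p ^ ?a) ^ ?a"
      using assms by (intro prob_gnp_has_biclique_le) auto
    also have "\<dots> \<le> ((real n)\<^sup>2 * p ^ ?a) ^ 1"
      using a le elim assms by (intro power_decreasing) auto
    finally have "measure_pmf.prob (gnp n p) {G. has_biclique n ?a G} \<le> f n"
      using le by simp
    moreover have "measure_pmf.prob (gnp n p) {G. \<not> has_biclique n ?a G}
        = 1 - measure_pmf.prob (gnp n p) {G. has_biclique n ?a G}"
      using measure_pmf.prob_compl[of "{G. has_biclique n ?a G}" "gnp n p"]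
      by (simp add: Collect_neg_eq Compl_eq_Diff_UNIV)
    ultimately show ?case by linarith
  qed
  have lim: "(\<lambda>n. 1 - f n) \<longlonglongrightarrow> 1" using tendsto_diff[OF tendsto_const f0, of 1] by simp
  show ?thesis
    by (rule tendsto_sandwich[OF lower _ lim tendsto_const]) simp
qed

section \<open>Choice of the exponent and passage to the limit\<close>

theorem theorem1p1:
  fixes L :: "nat ugraph"
  assumes "finite_graph L" and "bipartite L"
  shows "\<exists>\<epsilon>>0. \<forall>P :: nat ugraph set. hereditary_property P \<and> L \<notin> P \<longrightarrow>
           (\<forall>p::real. 0 < p \<and> p < 1 \<longrightarrow>
             (\<lambda>n. measure_pmf.prob (gnp n p) {G. real (ex_num G P) \<le> real n powr (2 - \<epsilon>)})
               \<longlonglongrightarrow> 1)"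
proof -
  obtain A B where AB: "A \<union> B = verts L" "A \<inter> B = {}"
      "\<forall>e\<in>edges L. \<exists>a\<in>A. \<exists>b\<in>B. e = {a, b}"
    using assms(2) unfolding bipartite_def by blast
  \<comment> \<open>The \<open>+ 1\<close> ensures \<open>1 \<le> s\<close> even if \<open>A\<close>
    is empty; \<open>M\<close> is chosen to meet both lower bounds of
    \<open>ex_num_le_if_no_biclique\<close>.\<close>
  define s where "s = card A + 1"
  define M where "M = (3 * s + 4) * (2 * s + 1) + 2 * s + 3 * card B + 4"
  define k where "k = M * s + M + 3 * s + 6"
  \<comment> \<open>For \<open>z = n powr \<delta>\<close> this gives \<open>z ^ (k + 2) = n\<close>
    and \<open>z ^ (2 * k + 3) = n powr (2 - \<delta>)\<close>. The exponent is fixed from a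
    bipartition of \<open>L\<close>, before \<open>P\<close> and \<open>p\<close>.\<close>
  define \<delta> :: real where "\<delta> = 1 / real (k + 2)"
  have \<delta>: "0 < \<delta>" by (simp add: \<delta>_def)
  show ?thesis
  proof (intro exI[of _ \<delta>] conjI allI impI \<delta>)
    fix P :: "nat ugraph set" and p :: real
    assume P: "hereditary_property P \<and> L \<notin> P" and p: "0 < p \<and> p < 1"
    have "filterlim (\<lambda>n. real n powr \<delta>) at_top sequentially"
      using \<delta> by real_asymp
    then have "\<forall>\<^sub>F n in sequentially. 4 + s + card B \<le> real n powr \<delta>"
      by (simp add: filterlim_at_top)
    moreover have "\<forall>\<^sub>F n in sequentially. n \<ge> (1::nat)" by (rule eventually_ge_at_top)
    ultimately have "\<forall>\<^sub>F n in sequentially.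
        measure_pmf.prob (gnp n p) {G. \<not> has_biclique n (nat \<lceil>real n powr \<delta>\<rceil>) G}
        \<le> measure_pmf.prob (gnp n p) {G. real (ex_num G P) \<le> real n powr (2 - \<delta>)}"
    proof eventually_elim
      case (elim n)
      let ?z = "real n powr \<delta>"
      have z_pow: "?z ^ i = real n powr (\<delta> * i)" for i
        using elim(2) by (simp add: powr_powr flip: powr_realpow)
      have "?z ^ (k + 2) = n" using elim(2) by (simp only: z_pow) (simp add: \<delta>_def)
      moreover have "\<delta> * real (2 * k + 3) = 2 - \<delta>"
        by (simp add: \<delta>_def field_simps)
      then have "?z ^ (2 * k + 3) = real n powr (2 - \<delta>)" by (simp only: z_pow)
      moreover have "ex_num G P \<le> ?z ^ (2 * k + 3)"
        if G: "G \<in> set_pmf (gnp n p)" "\<not> has_biclique n (nat \<lceil>?z\<rceil>) G" and "real n \<le> ?z ^ (k + 2)" for G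
      proof -
        have Gv: "verts G = {1..n}" "edges G \<subseteq> nsets {1..n} 2"
          using G(1) by (auto simp: gnp_def)
        show ?thesis
          unfolding k_def
        proof (rule ex_num_le_if_no_biclique[OF assms(1) AB])
          show "finite_graph G" using Gv by (simp add: finite_graph_def)
          show "card (verts G) \<le> ?z ^ (M * s + M + 3 * s + 6 + 2)"
            using that(3) by (simp add: Gv k_def)
          show "\<exists>x\<in>X. \<exists>y\<in>Y. {x, y} \<notin> edges G"
            if "X \<subseteq> verts G" "Y \<subseteq> verts G" "X \<inter> Y = {}" "card X = nat \<lceil>?z\<rceil>" "card Y = nat \<lceil>?z\<rceil>" for X Y
            using no_bicliqueD[OF G(2)] that unfolding Gv(1) .
        qed (use P elim(1) in \<open>auto simp: s_def M_def\<close>)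
      qed
      \<comment> \<open>Only graphs in the support are known to have vertex set
        \<open>{1..n}\<close>; intersecting with the support leaves the probability
        unchanged.\<close>
      ultimately have "{G. \<not> has_biclique n (nat \<lceil>?z\<rceil>) G} \<inter> set_pmf (gnp n p)
          \<subseteq> {G. real (ex_num G P) \<le> real n powr (2 - \<delta>)}" by auto
      then have "measure_pmf.prob (gnp n p) ({G. \<not> has_biclique n (nat \<lceil>?z\<rceil>) G} \<inter> set_pmf (gnp n p))
          \<le> measure_pmf.prob (gnp n p) {G. real (ex_num G P) \<le> real n powr (2 - \<delta>)}"
        by (intro measure_pmf.finite_measure_mono) auto
      then show ?case by (simp add: measure_Int_set_pmf)
    qed
    then show "(\<lambda>n. measure_pmf.prob (gnp n p) {G. real (ex_num G P) \<le> real n powr (2 - \<delta>)}) \<longlonglongrightarrow> 1"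
      by (rule tendsto_sandwich[OF _ _ prob_gnp_no_biclique_tendsto_1 tendsto_const])
        (use p \<delta> in auto)
  qed
qed

end
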